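(* Let $X,Y$ be finite sets, let $m,n\in\mathbb{N}$, let $f=(u,p):X^{m}\to Y^{n}$ be a multiset mapping, and let $A,B\in X^{m}$. (1) If $f$ is $u$-injective and $p$-bijective, then (i) $d(A,B)=d(f(A),f(B))$ and (ii) $S(A,B)=S(f(A),f(B))$. (2) If $m>n$ and $f$ is $p$-surjective, then $\#A\ge \#f(A)$. (3) If $f$ is injective, then $\#A\le \#f(A)$.
   Context: $\mathbb{N}$ denotes the non-negative integers. For a set $X$ and $m\in\mathbb{N}$, put $m^{\ast}=\{0,1,\dots,m\}$; the multiset space $X^{m}$ is the set of all functions $A:X\to m^{\ast}$ (multisets over $X$ with multiplicities at most $m$, identified with their count functions). A map $p:m^{\ast}\to n^{\ast}$ is order preserving (OP) if $p(0)=0$, $p(m)=n$, and $p(i)\ge p(i-1)$ for all $1\le i\le m$. A multiset mapping $f=(u,p):X^{m}\to Y^{n}$ consists of an ordinary map $u:X\to Y$ and an OP map $p:m^{\ast}\to n^{\ast}$. It is called $u$-injective if $u$ is injective; $p$-surjective (resp. $p$-bijective) if $p$ is surjective (resp. bijective); and injective if both $u$ and $p$ are injective. The image of $A\in X^{m}$ is the element $f(A)\in Y^{n}$ given by $f(A)(y)=p\big(\bigvee_{x\in u^{-1}(y)}A(x)\big)$ if $u^{-1}(y)\neq\emptyset$, and $f(A)(y)=0$ otherwise, where $\bigvee$ denotes supremum (maximum). The cardinality of $A\in X^{m}$ is $\#A=\sum_{x\in X}A(x)$. For $A,B\in X^{m}$, $d(A,B)=\sqrt{\sum_{x\in X}(A(x)-B(x))^{2}}$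 and $S(A,B)=\frac{1}{1+d(A,B)}$; the same formulas (with $Y$ in place of $X$) define $\#$, $d$ and $S$ on $Y^{n}$. *)

theory Defs
  imports Complex_Main "HOL-Library.FuncSet"
begin

definition mset_space :: "'a set \<Rightarrow> nat \<Rightarrow> ('a \<Rightarrow> nat) set" where
  "mset_space X m = (X \<rightarrow>\<^sub>E {0..m})"

definition order_pres :: "nat \<Rightarrow> nat \<Rightarrow> (nat \<Rightarrow> nat) \<Rightarrow> bool" where
  "order_pres m n p \<longleftrightarrow>
     p \<in> {0..m} \<rightarrow> {0..n} \<and> p 0 = 0 \<and> p m = n \<and> (\<forall>i\<in>{1..m}. p (i - 1) \<le> p i)"

(* A multiset mapping is the pair (u, p) of the element map and the count map.
   Only the values of u on X and of p on {0..m} are relevant. *)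
type_synonym ('a, 'b) mset_map = "('a \<Rightarrow> 'b) \<times> (nat \<Rightarrow> nat)"

definition is_mset_map ::
  "'a set \<Rightarrow> nat \<Rightarrow> 'b set \<Rightarrow> nat \<Rightarrow> ('a, 'b) mset_map \<Rightarrow> bool" where
  "is_mset_map X m Y n f \<longleftrightarrow> fst f \<in> X \<rightarrow> Y \<and> order_pres m n (snd f)"

definition u_injective :: "'a set \<Rightarrow> ('a, 'b) mset_map \<Rightarrow> bool" where
  "u_injective X f \<longleftrightarrow> inj_on (fst f) X"

definition p_injective :: "nat \<Rightarrow> ('a, 'b) mset_map \<Rightarrow> bool" where
  "p_injective m f \<longleftrightarrow> inj_on (snd f) {0..m}"

definition p_surjective :: "nat \<Rightarrow> nat \<Rightarrow> ('a, 'b) mset_map \<Rightarrow> bool" where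
  "p_surjective m n f \<longleftrightarrow> snd f ` {0..m} = {0..n}"

definition p_bijective :: "nat \<Rightarrow> nat \<Rightarrow> ('a, 'b) mset_map \<Rightarrow> bool" where
  "p_bijective m n f \<longleftrightarrow> bij_betw (snd f) {0..m} {0..n}"

definition mset_map_injective :: "'a set \<Rightarrow> nat \<Rightarrow> ('a, 'b) mset_map \<Rightarrow> bool" where
  "mset_map_injective X m f \<longleftrightarrow> u_injective X f \<and> p_injective m f"

(* The restriction to Y makes the image an element of mset_space Y n. *)
definition mset_image ::
  "'a set \<Rightarrow> 'b set \<Rightarrow> ('a, 'b) mset_map \<Rightarrow> ('a \<Rightarrow> nat) \<Rightarrow> 'b \<Rightarrow> nat" where
  "mset_image X Y f A = (\<lambda>y\<in>Y.
     if {x \<in> X. fst f x = y} \<noteq> {} then snd f (SUP x\<in>{x \<in> X. fst f x = y}. A x) else 0)"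

definition mset_card :: "'a set \<Rightarrow> ('a \<Rightarrow> nat) \<Rightarrow> nat" where
  "mset_card X A = (\<Sum>x\<in>X. A x)"

definition mset_dist :: "'a set \<Rightarrow> ('a \<Rightarrow> nat) \<Rightarrow> ('a \<Rightarrow> nat) \<Rightarrow> real" where
  "mset_dist X A B = sqrt (\<Sum>x\<in>X. (real (A x) - real (B x))\<^sup>2)"

definition mset_sim :: "'a set \<Rightarrow> ('a \<Rightarrow> nat) \<Rightarrow> ('a \<Rightarrow> nat) \<Rightarrow> real" where
  "mset_sim X A B = 1 / (1 + mset_dist X A B)"

lemma mset_image_in_mset_space:
  assumes "is_mset_map X m Y n f" "A \<in> mset_space X m"
  shows "mset_image X Y f A \<in> mset_space Y n"
proof -
  have "snd f (SUP x\<in>{x \<in> X. fst f x = y}. A x) \<in> {0..n}"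
    if "{x \<in> X. fst f x = y} \<noteq> {}" for y
  proof -
    have "(SUP x\<in>{x \<in> X. fst f x = y}. A x) \<le> m"
      using that assms(2) by (intro cSUP_least) (auto simp: mset_space_def PiE_iff)
    then show ?thesis
      using assms(1) by (auto simp: is_mset_map_def order_pres_def Pi_iff)
  qed
  then show ?thesis
    unfolding mset_image_def mset_space_def by (auto split: if_splits)
qed

end

(* Counting the values of an order preserving p on {0..i} gives p i <= i if p is surjective and
   i <= p i if p is injective, so a bijective p is the identity on {0..m}. *)
theory Submission
  imports Defs
begin

text \<open>Two facts carry the theorem. On the count side, \<open>p\<close> is compared with the
  identity: below it if surjective (\<open>order_pres_surj_le\<close>), above it if injective
  (\<open>order_pres_inj_ge\<close>). On the element side, a supremum over a nonempty finite fibre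
  of \<open>u\<close> is attained, so there the image of \<open>A\<close> takes the value
  \<open>p (A x)\<close> for some \<open>x\<close> in the fibre (\<open>mset_image_fibre\<close>).
  For surjective \<open>p\<close> this value is at most \<open>A x\<close>, hence at most the sum of
  \<open>A\<close> over the fibre, and the fibres partition \<open>X\<close>.\<close>

lemma order_pres_mono:
  assumes "order_pres m n p" "i \<le> j" "j \<le> m"
  shows "p i \<le> p j"
  using assms(2,3)
proof (induction j rule: dec_induct)
  case (step j)
  then have "Suc j \<in> {1..m}" by simp
  then have "p (Suc j - 1) \<le> p (Suc j)"
    using assms(1) unfolding order_pres_def by blast
  with step show ?case by simp
qed simp

text \<open>By monotonicity and surjectivity, all \<open>p i + 1\<close> values up to
  \<open>p i\<close> are already taken on the \<open>i + 1\<close> arguments up to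
  \<open>i\<close>.\<close>

lemma order_pres_surj_le:
  assumes p: "order_pres m n p" "p ` {0..m} = {0..n}" and i: "i \<le> m"
  shows "p i \<le> i"
proof -
  have "{0..p i} \<subseteq> p ` {0..i}"
  proof
    fix k assume k: "k \<in> {0..p i}"
    have "p i \<in> p ` {0..m}" using i by simp
    then have "k \<in> p ` {0..m}" using k unfolding p(2) by simp
    then obtain j where j: "j \<le> m" "k = p j" by auto
    show "k \<in> p ` {0..i}"
    proof (cases "j \<le> i")
      \<comment> \<open>Here \<open>p i \<le> p j = k \<le> p i\<close>, so \<open>k\<close> is
        \<open>p i\<close> itself, taken at \<open>i\<close>.\<close>
      case False
      then have "p i \<le> p j" using order_pres_mono[OF p(1)] j(1) by simp
      with k j show ?thesis by auto
    qed (use j in auto)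
  qed
  then have "card {0..p i} \<le> card {0..i}"
    by (intro surj_card_le) simp_all
  then show ?thesis by simp
qed

text \<open>Monotonicity keeps the \<open>i + 1\<close> distinct values on \<open>{0..i}\<close>
  inside \<open>{0..p i}\<close>.\<close>

lemma order_pres_inj_ge:
  assumes p: "order_pres m n p" "inj_on p {0..m}" and i: "i \<le> m"
  shows "i \<le> p i"
proof -
  have "card {0..i} \<le> card {0..p i}"
  proof (rule card_inj_on_le)
    show "inj_on p {0..i}" using p(2) i by (auto intro: inj_on_subset)
    show "p ` {0..i} \<subseteq> {0..p i}" using order_pres_mono[OF p(1)] i by auto
  qed simp
  then show ?thesis by simp
qed

lemma mset_image_outside:
  "y \<in> Y \<Longrightarrow> y \<notin> fst f ` X \<Longrightarrow> mset_image X Y f A y = 0"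
  unfolding mset_image_def by auto

text \<open>A finite nonempty set of naturals contains its supremum; naming a point \<open>x\<close>
  that attains it removes suprema from all later arguments.\<close>

lemma mset_image_fibre:
  assumes "finite X" "fst f \<in> X \<rightarrow> Y" "y \<in> fst f ` X"
  obtains x where "x \<in> X" "fst f x = y" "mset_image X Y f A y = snd f (A x)"
proof -
  let ?F = "{x \<in> X. fst f x = y}"
  have F: "finite ?F" "?F \<noteq> {}" using assms by auto
  then have "Sup (A ` ?F) = Max (A ` ?F)" by (intro cSup_eq_Max) auto
  also have "\<dots> \<in> A ` ?F" using F by (intro Max_in) auto
  finally have "(SUP x\<in>?F. A x) \<in> A ` ?F" .
  then obtain x where x: "x \<in> ?F" "(SUP x\<in>?F. A x) = A x" by blast
  have "y \<in> Y" using assms(2,3) by auto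
  with F(2) x(2) have "mset_image X Y f A y = snd f (A x)"
    by (simp only: mset_image_def restrict_apply if_True not_False_eq_True)
  with x(1) show thesis by (intro that) auto
qed

lemma mset_image_u_injective:
  assumes "finite X" "fst f \<in> X \<rightarrow> Y" "u_injective X f" "x \<in> X"
  shows "mset_image X Y f A (fst f x) = snd f (A x)"
proof -
  obtain x' where "x' \<in> X" "fst f x' = fst f x" "mset_image X Y f A (fst f x) = snd f (A x')"
    using mset_image_fibre[OF assms(1,2) imageI[OF assms(4)]] .
  with assms(3,4) show ?thesis by (auto simp: u_injective_def dest: inj_onD)
qed

text \<open>Transfers both squared distances and cardinalities from \<open>Y\<close> back to
  \<open>X\<close>.\<close>

lemma sum_reindex_zero_outside:
  assumes "finite Y" "u \<in> X \<rightarrow> Y" "inj_on u X" "\<And>y. y \<in> Y \<Longrightarrow> y \<notin> u ` X \<Longrightarrow> h y = 0"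
  shows "sum h Y = (\<Sum>x\<in>X. h (u x))"
proof -
  have "sum h Y = sum h (u ` X)"
    using assms by (intro sum.mono_neutral_right) auto
  also have "\<dots> = (\<Sum>x\<in>X. h (u x))"
    using assms(3) by (simp add: sum.reindex)
  finally show ?thesis .
qed

lemma mset_dist_mset_image:
  assumes XY: "finite X" "finite Y" and f: "is_mset_map X m Y n f"
    and AB: "A \<in> mset_space X m" "B \<in> mset_space X m"
    and "u_injective X f" "p_bijective m n f"
  shows "mset_dist Y (mset_image X Y f A) (mset_image X Y f B) = mset_dist X A B"
proof -
  have u: "fst f \<in> X \<rightarrow> Y" and p: "order_pres m n (snd f)"
    using f by (auto simp: is_mset_map_def)
  \<comment> \<open>The two comparisons with the identity pinch \<open>p\<close>.\<close>
  have id: "snd f i = i" if "i \<le> m" for i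
    using order_pres_surj_le[OF p _ that] order_pres_inj_ge[OF p _ that] assms(7)
    by (simp add: p_bijective_def bij_betw_def)
  have image: "mset_image X Y f C (fst f x) = C x" if "x \<in> X" "C \<in> mset_space X m" for x C
  proof -
    have "C x \<le> m" using that by (auto simp: mset_space_def PiE_iff)
    then show ?thesis
      using mset_image_u_injective[OF XY(1) u assms(6) that(1)] id by simp
  qed
  have "(\<Sum>y\<in>Y. (real (mset_image X Y f A y) - real (mset_image X Y f B y))\<^sup>2)
      = (\<Sum>x\<in>X. (real (mset_image X Y f A (fst f x)) - real (mset_image X Y f B (fst f x)))\<^sup>2)"
    \<comment> \<open>Off the range of \<open>u\<close> both images are 0, so the squared difference
      vanishes.\<close>
    using assms(6) by (intro sum_reindex_zero_outside XY u)
      (auto simp: u_injective_def mset_image_outside)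
  also have "\<dots> = (\<Sum>x\<in>X. (real (A x) - real (B x))\<^sup>2)"
    using image AB by simp
  finally show ?thesis by (simp add: mset_dist_def)
qed

lemma mset_card_mset_image_le:
  assumes XY: "finite X" "finite Y" and f: "is_mset_map X m Y n f"
    and A: "A \<in> mset_space X m" and "p_surjective m n f"
  shows "mset_card Y (mset_image X Y f A) \<le> mset_card X A"
proof -
  have u: "fst f \<in> X \<rightarrow> Y" and p: "order_pres m n (snd f)"
    using f by (auto simp: is_mset_map_def)
  have "mset_image X Y f A y \<le> (\<Sum>x\<in>{x \<in> X. fst f x = y}. A x)" if "y \<in> Y" for y
  proof (cases "y \<in> fst f ` X")
    case True
    then obtain x where x: "x \<in> X" "fst f x = y" "mset_image X Y f A y = snd f (A x)"
      by (rule mset_image_fibre[OF XY(1) u])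
    have "snd f (A x) \<le> A x"
      using assms(5) A x(1)
      by (intro order_pres_surj_le[OF p]) (auto simp: p_surjective_def mset_space_def PiE_iff)
    also have "A x \<le> (\<Sum>x\<in>{x \<in> X. fst f x = y}. A x)"
      using x XY(1) by (intro member_le_sum) auto
    finally show ?thesis using x(3) by simp
  qed (simp add: mset_image_outside that)
  then have "mset_card Y (mset_image X Y f A) \<le> (\<Sum>y\<in>Y. \<Sum>x\<in>{x \<in> X. fst f x = y}. A x)"
    unfolding mset_card_def by (rule sum_mono)
  \<comment> \<open>The fibres of \<open>u\<close> over points of \<open>Y\<close> partition
    \<open>X\<close>, empty ones adding 0.\<close>
  also have "\<dots> = mset_card X A"
    unfolding mset_card_def using XY u by (intro sum.group) auto
  finally show ?thesis .
qed

text \<open>With \<open>u\<close> injective no element is absorbed into a maximum: each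
  \<open>x\<close> keeps its own term \<open>p (A x)\<close>, which is at least
  \<open>A x\<close>.\<close>

lemma mset_card_mset_image_ge:
  assumes XY: "finite X" "finite Y" and f: "is_mset_map X m Y n f"
    and A: "A \<in> mset_space X m" and inj: "mset_map_injective X m f"
  shows "mset_card X A \<le> mset_card Y (mset_image X Y f A)"
proof -
  have u: "fst f \<in> X \<rightarrow> Y" and p: "order_pres m n (snd f)"
    using f by (auto simp: is_mset_map_def)
  have ui: "u_injective X f" and pi: "inj_on (snd f) {0..m}"
    using inj by (auto simp: mset_map_injective_def p_injective_def)
  have "mset_card X A \<le> (\<Sum>x\<in>X. mset_image X Y f A (fst f x))"
    unfolding mset_card_def
  proof (rule sum_mono)
    fix x assume x: "x \<in> X"
    then have "A x \<le> m" using A by (auto simp: mset_space_def PiE_iff)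
    then show "A x \<le> mset_image X Y f A (fst f x)"
      using mset_image_u_injective[OF XY(1) u ui x] order_pres_inj_ge[OF p pi] by simp
  qed
  also have "\<dots> = mset_card Y (mset_image X Y f A)"
    unfolding mset_card_def using ui
    by (intro sum_reindex_zero_outside[symmetric] XY u)
      (auto simp: u_injective_def mset_image_outside)
  finally show ?thesis .
qed

theorem theorem5p2:
  fixes X :: "'a set" and Y :: "'b set" and m n :: nat
    and f :: "('a, 'b) mset_map" and A B :: "'a \<Rightarrow> nat"
  assumes "finite X" and "finite Y"
    and "is_mset_map X m Y n f"
    and "A \<in> mset_space X m" and "B \<in> mset_space X m"
  shows "(u_injective X f \<and> p_bijective m n f \<longrightarrow>
            mset_dist X A B = mset_dist Y (mset_image X Y f A) (mset_image X Y f B) \<and>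
            mset_sim X A B = mset_sim Y (mset_image X Y f A) (mset_image X Y f B))
       \<and> (m > n \<and> p_surjective m n f \<longrightarrow>
            mset_card X A \<ge> mset_card Y (mset_image X Y f A))
       \<and> (mset_map_injective X m f \<longrightarrow>
            mset_card X A \<le> mset_card Y (mset_image X Y f A))"
  using mset_dist_mset_image[OF assms] mset_card_mset_image_le[OF assms(1-4)]
    mset_card_mset_image_ge[OF assms(1-4)]
  by (simp add: mset_sim_def)

end
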